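(* Let $(V,\omega)$ be a symplectic real vector space of dimension $2n$ with a fixed basis, and let $L\in\mathbb{M}_{2n}(\mathbb{R})$. Then $L\in\mathfrak{sp}_{\omega}(n;\mathbb{R})$ if and only if the linear vector field $X:V\to V$, $X(x)=L\mathbf{x}$ (where $\mathbf{x}$ is the coordinate column of $x$), is $\omega$-Hamiltonian.
   Context: A symplectic vector space $(V,\omega)$ is a finite-dimensional real vector space $V$ (of even dimension $2n$) with an alternating non-degenerate bilinear form $\omega:V\times V\to\mathbb{R}$. A (not necessarily symplectic) basis of $V$ is fixed, vectors are identified with their coordinate columns, and $[\omega]\in\mathbb{M}_{2n}(\mathbb{R})$ is the (skew-symmetric, invertible) matrix of $\omega$ in this basis, so $\omega(\mathbf u,\mathbf v)=\mathbf u^T[\omega]\mathbf v$. A vector field $X:V\to V$ is $\omega$-Hamiltonian if there is a smooth function $H:V\to\mathbb{R}$ such that $\omega(X(x),\cdot)=dH_x$ for all $x\in V$; equivalently $X(x)=([\omega]^{-1})^T\nabla H(x)$, where $\nabla H$ is the column of partial derivatives of $H$ in the fixed basis. $\mathfrak{sp}_{\omega}(n;\mathbb{R})=\{L\in\mathbb{M}_{2n}(\mathbb{R}): L^T[\omega]+[\omega]L=0\}$. *)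

theory Defs
  imports "HOL-Analysis.Analysis"
begin

text \<open>The ambient vector space is a type of class \<^class>\<open>real_normed_vector\<close> that has a
  finite basis. The norm is there only so that derivatives make sense: on a finite-dimensional
  space all norms are equivalent, so differentiability, derivatives and smoothness do not
  depend on it.\<close>

definition is_basis :: "('m::finite \<Rightarrow> 'v::real_vector) \<Rightarrow> bool" where
  "is_basis b \<longleftrightarrow> inj b \<and> independent (range b) \<and> span (range b) = UNIV"

definition coords :: "('m::finite \<Rightarrow> 'v::real_vector) \<Rightarrow> 'v \<Rightarrow> real^'m" where
  "coords b x = (\<chi> i. representation (range b) x (b i))"

definition vec_of_coords :: "('m::finite \<Rightarrow> 'v::real_vector) \<Rightarrow> real^'m \<Rightarrow> 'v" where
  "vec_of_coords b c = (\<Sum>i\<in>UNIV. (c $ i) *\<^sub>R b i)"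

definition symplectic_form :: "('v::real_vector \<Rightarrow> 'v \<Rightarrow> real) \<Rightarrow> bool" where
  "symplectic_form \<omega> \<longleftrightarrow>
     bilinear \<omega> \<and> (\<forall>u. \<omega> u u = 0) \<and> (\<forall>u. (\<forall>v. \<omega> u v = 0) \<longrightarrow> u = 0)"

definition form_matrix ::
    "('m::finite \<Rightarrow> 'v::real_vector) \<Rightarrow> ('v \<Rightarrow> 'v \<Rightarrow> real) \<Rightarrow> real^'m^'m" where
  "form_matrix b \<omega> = (\<chi> i j. \<omega> (b i) (b j))"

definition sp_algebra ::
    "('m::finite \<Rightarrow> 'v::real_vector) \<Rightarrow> ('v \<Rightarrow> 'v \<Rightarrow> real) \<Rightarrow> (real^'m^'m) set" where
  "sp_algebra b \<omega> = {L. transpose L ** form_matrix b \<omega> + form_matrix b \<omega> ** L = 0}"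

text \<open>On a finite-dimensional domain, being of class \<open>C\<^sup>k\<close> can be tested on the directional
  derivatives \<open>x \<mapsto> Df(x) v\<close> for each fixed direction \<open>v\<close>; this keeps the
  recursion at a single type.\<close>

fun Ck :: "nat \<Rightarrow> ('v::real_normed_vector \<Rightarrow> real) \<Rightarrow> bool" where
  "Ck 0 f \<longleftrightarrow> continuous_on UNIV f"
| "Ck (Suc k) f \<longleftrightarrow>
     (\<forall>x. f differentiable (at x)) \<and> (\<forall>v. Ck k (\<lambda>x. frechet_derivative f (at x) v))"

definition smooth :: "('v::real_normed_vector \<Rightarrow> real) \<Rightarrow> bool" where
  "smooth f \<longleftrightarrow> (\<forall>k. Ck k f)"

definition hamiltonian_field ::
    "('v::real_normed_vector \<Rightarrow> 'v \<Rightarrow> real) \<Rightarrow> ('v \<Rightarrow> 'v) \<Rightarrow> bool" where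
  "hamiltonian_field \<omega> X \<longleftrightarrow>
     (\<exists>H. smooth H \<and> (\<forall>x. (H has_derivative (\<lambda>v. \<omega> (X x) v)) (at x)))"

definition linear_field ::
    "('m::finite \<Rightarrow> 'v::real_vector) \<Rightarrow> real^'m^'m \<Rightarrow> 'v \<Rightarrow> 'v" where
  "linear_field b L x = vec_of_coords b (L *v coords b x)"

end

theory Submission imports Defs begin

text \<open>Write \<open>A\<close> for the linear field of \<open>L\<close> and \<open>B(x,v) = \<omega>(A x, v)\<close>. In coordinates,
  \<open>L \<in> sp\<close> says \<open>\<omega>(A x, y) + \<omega>(x, A y) = 0\<close>, and since \<open>\<omega>\<close> is alternating this
  means that \<open>B\<close> is symmetric. If \<open>B\<close> is symmetric, then \<open>H(x) = B(x,x)/2\<close> is a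
  Hamiltonian. Conversely, if \<open>dH\<^sub>x = B(x,\<cdot>)\<close>, integrating along the ray through \<open>x\<close>
  gives \<open>H(x) = H(0) + B(x,x)/2\<close>; differentiating this once more yields
  \<open>B(x,v) = (B(x,v) + B(v,x))/2\<close>, so no theorem on mixed partial derivatives is needed.\<close>

section \<open>Coordinates in a basis; continuity of linear and bilinear maps\<close>

lemma vec_of_coords_coords:
  assumes "is_basis b"
  shows "vec_of_coords b (coords b x) = x"
proof -
  have b: "inj b" "independent (range b)" "x \<in> span (range b)"
    using assms by (auto simp: is_basis_def)
  have "vec_of_coords b (coords b x) = (\<Sum>i\<in>UNIV. representation (range b) x (b i) *\<^sub>R b i)"
    by (simp add: vec_of_coords_def coords_def)
  also have "\<dots> = (\<Sum>v\<in>range b. representation (range b) x v *\<^sub>R v)"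
    using b(1) by (simp add: sum.reindex)
  also have "\<dots> = x"
    using real_vector.sum_representation_eq[OF b(2,3)] by simp
  finally show ?thesis .
qed

lemma linear_vec_of_coords: "linear (vec_of_coords b)"
  unfolding vec_of_coords_def
  by (intro linearI) (simp_all add: scaleR_add_left sum.distrib scaleR_right.sum)

lemma linear_coords:
  assumes "is_basis b"
  shows "linear (coords b)"
  using assms unfolding is_basis_def coords_def
  by (intro linearI)
    (simp_all add: vec_eq_iff real_vector.representation_add real_vector.representation_scale)

lemma coords_basis:
  assumes "is_basis b"
  shows "coords b (b j) = axis j 1"
proof -
  have "inj b" "independent (range b)"
    using assms by (auto simp: is_basis_def)
  then show ?thesis
    by (auto simp: coords_def axis_def vec_eq_iff real_vector.representation_basis inj_eq)
qed

lemma coords_vec_of_coords: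
  assumes "is_basis b"
  shows "coords b (vec_of_coords b c) = c"
proof -
  interpret linear "coords b" by (rule linear_coords[OF assms])
  have "coords b (vec_of_coords b c) = (\<Sum>i\<in>UNIV. c $ i *\<^sub>R axis i 1)"
    by (simp add: vec_of_coords_def sum scaleR coords_basis[OF assms])
  also have "\<dots> = c"
    using basis_expansion[of c] by (simp add: scalar_mult_eq_scaleR)
  finally show ?thesis .
qed

text \<open>The unit sphere is compact, so \<open>norm (f x)\<close> attains a minimum on it;
  injectivity makes this minimum positive, and homogeneity carries the bound to all vectors.\<close>

lemma linear_inj_euclidean_bounded_below:
  fixes f :: "'a::euclidean_space \<Rightarrow> 'b::real_normed_vector"
  assumes "linear f" "inj f"
  obtains B where "B > 0" "\<And>x. B * norm x \<le> norm (f x)"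
proof -
  interpret linear f by (rule assms(1))
  have "continuous_on (sphere 0 1) (\<lambda>x. norm (f x))"
    using assms(1) by (intro continuous_on_norm linear_continuous_on)
      (simp add: linear_conv_bounded_linear)
  then obtain u where u: "u \<in> sphere 0 1" "\<And>x. x \<in> sphere 0 1 \<Longrightarrow> norm (f u) \<le> norm (f x)"
    using continuous_attains_inf[of "sphere 0 1" "\<lambda>x. norm (f x)"] by auto
  show thesis
  proof
    show "norm (f u) > 0"
      using u(1) injD[OF assms(2), of u 0] by (auto simp: zero)
  next
    fix x
    show "norm (f u) * norm x \<le> norm (f x)"
    proof (cases "x = 0")
      case False
      then have "norm (f u) \<le> norm (f ((1 / norm x) *\<^sub>R x))"
        by (intro u(2)) simp
      also have "\<dots> = norm (f x) / norm x"
        by (simp add: scaleR)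
      finally show ?thesis
        using False by (simp add: field_simps)
    qed simp
  qed
qed

text \<open>The norm on \<open>'v\<close> is arbitrary, so continuity has to be derived: a lower
  bound for \<open>vec_of_coords b\<close> is an upper bound for its inverse
  \<open>coords b\<close>.\<close>

lemma bounded_linear_coords:
  fixes b :: "'m::finite \<Rightarrow> 'v::real_normed_vector"
  assumes "is_basis b"
  shows "bounded_linear (coords b)"
proof -
  have "inj (vec_of_coords b)"
    by (rule inj_on_inverseI[where g = "coords b"]) (rule coords_vec_of_coords[OF assms])
  then obtain B where B: "B > 0" "\<And>c. B * norm c \<le> norm (vec_of_coords b c)"
    using linear_inj_euclidean_bounded_below[OF linear_vec_of_coords] by blast
  have "norm (coords b x) \<le> norm x * (1 / B)" for x
    using B(2)[of "coords b x"] B(1) by (simp add: vec_of_coords_coords[OF assms] field_simps)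
  then show ?thesis
    using linear_coords[OF assms] by (metis bounded_linear.intro bounded_linear_axioms.intro)
qed

text \<open>Transported to coordinate columns, the map is bilinear on a Euclidean space and hence
  bounded; composing with the bounded map \<open>coords b\<close> returns to
  \<open>'v\<close>.\<close>

lemma bounded_bilinear_of_basis:
  fixes b :: "'m::finite \<Rightarrow> 'v::real_normed_vector"
    and \<beta> :: "'v \<Rightarrow> 'v \<Rightarrow> 'w::real_normed_vector"
  assumes "is_basis b" "bilinear \<beta>"
  shows "bounded_bilinear \<beta>"
proof -
  let ?\<gamma> = "\<lambda>c d. \<beta> (vec_of_coords b c) (vec_of_coords b d)"
  have "bilinear ?\<gamma>"
    using assms(2) linear_vec_of_coords[of b]
    unfolding bilinear_def by (auto intro: linear_compose[unfolded o_def])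
  then have "bounded_bilinear ?\<gamma>"
    by (simp add: bilinear_conv_bounded_bilinear)
  from bounded_bilinear.comp[OF this bounded_linear_coords[OF assms(1)] bounded_linear_coords[OF assms(1)]]
  show ?thesis
    by (simp add: vec_of_coords_coords[OF assms(1)])
qed

section \<open>Matrix and form versions of the condition on \<open>L\<close>\<close>

lemma form_eq_form_matrix:
  assumes "bilinear \<omega>"
  shows "\<omega> (vec_of_coords b c) (vec_of_coords b d) = c \<bullet> (form_matrix b \<omega> *v d)"
proof -
  have "\<omega> (vec_of_coords b c) (vec_of_coords b d)
      = (\<Sum>i\<in>UNIV. \<Sum>j\<in>UNIV. \<omega> (c $ i *\<^sub>R b i) (d $ j *\<^sub>R b j))"
    by (simp add: vec_of_coords_def bilinear_sum[OF assms] sum.cartesian_product)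
  then show ?thesis
    by (simp add: bilinear_lmul[OF assms] bilinear_rmul[OF assms] inner_vec_def
        matrix_vector_mult_def form_matrix_def sum_distrib_left mult_ac)
qed

lemma sp_algebra_iff:
  assumes "is_basis b" "bilinear \<omega>"
  shows "L \<in> sp_algebra b \<omega> \<longleftrightarrow>
    (\<forall>x y. \<omega> (linear_field b L x) y + \<omega> x (linear_field b L y) = 0)"
proof -
  let ?M = "transpose L ** form_matrix b \<omega> + form_matrix b \<omega> ** L"
  have *: "\<omega> (linear_field b L x) y + \<omega> x (linear_field b L y) = coords b x \<bullet> (?M *v coords b y)"
    for x y
  proof -
    have "\<omega> (linear_field b L x) y = (L *v coords b x) \<bullet> (form_matrix b \<omega> *v coords b y)"
      using form_eq_form_matrix[OF assms(2), of b "L *v coords b x" "coords b y"]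
      by (simp add: linear_field_def vec_of_coords_coords[OF assms(1)])
    moreover have "\<omega> x (linear_field b L y) = coords b x \<bullet> (form_matrix b \<omega> *v (L *v coords b y))"
      using form_eq_form_matrix[OF assms(2), of b "coords b x" "L *v coords b y"]
      by (simp add: linear_field_def vec_of_coords_coords[OF assms(1)])
    moreover have "coords b x \<bullet> (transpose L *v v) = (L *v coords b x) \<bullet> v" for v
      by (metis dot_lmul_matrix vector_transpose_matrix)
    ultimately show ?thesis
      by (simp add: matrix_vector_mult_add_rdistrib inner_add_right
          matrix_vector_mul_assoc[symmetric] del: transpose_matrix_vector)
  qed
  \<comment> \<open>Taking \<open>c = ?M *v d\<close> turns the right-hand side into
    \<open>?M *v d = 0\<close> for every \<open>d\<close>.\<close>
  have "?M = 0 \<longleftrightarrow> (\<forall>c d. c \<bullet> (?M *v d) = 0)"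
    by (metis inner_eq_zero_iff inner_zero_right matrix_eq matrix_vector_mult_0)
  also have "\<dots> \<longleftrightarrow> (\<forall>x y. coords b x \<bullet> (?M *v coords b y) = 0)"
    by (metis coords_vec_of_coords[OF assms(1)])
  finally show ?thesis
    by (simp add: sp_algebra_def *)
qed

lemma linear_linear_field:
  assumes "is_basis b"
  shows "linear (linear_field b L)"
  unfolding linear_field_def
  by (intro linear_compose[OF linear_coords[OF assms], unfolded o_def]
      linear_compose[OF matrix_vector_mul_linear linear_vec_of_coords, unfolded o_def])

text \<open>Polarization: expand \<open>\<omega> (u + v) (u + v) = 0\<close>.\<close>

lemma symplectic_form_skew:
  assumes "symplectic_form \<omega>"
  shows "\<omega> u v = - \<omega> v u"
proof -
  have \<omega>: "bilinear \<omega>" "\<And>u. \<omega> u u = 0"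
    using assms by (auto simp: symplectic_form_def)
  have "\<omega> (u + v) (u + v) = \<omega> u u + \<omega> u v + (\<omega> v u + \<omega> v v)"
    by (simp add: bilinear_ladd[OF \<omega>(1)] bilinear_radd[OF \<omega>(1)])
  then show ?thesis by (simp add: \<omega>(2))
qed

section \<open>Smooth potentials of bilinear fields\<close>

lemma Ck_const: "Ck k (\<lambda>x. c)"
  by (induction k arbitrary: c) (simp_all add: frechet_derivative_const)

text \<open>A bounded linear map is its own derivative at every point, so its directional
  derivatives are constant functions.\<close>

lemma Ck_bounded_linear:
  assumes "bounded_linear f"
  shows "Ck k f"
proof (cases k)
  case 0
  then show ?thesis
    using assms by (simp add: linear_continuous_on)
next
  case (Suc k')
  have "(f has_derivative f) (at x)" for x
    using assms by (rule bounded_linear_imp_has_derivative)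
  then have "frechet_derivative f (at x) = f" "f differentiable (at x)" for x
    by (metis frechet_derivative_at, auto simp: differentiable_def)
  then show ?thesis
    using Suc by (simp add: Ck_const)
qed

lemma has_derivative_quadratic:
  assumes "bounded_bilinear B"
  shows "((\<lambda>x. B x x) has_derivative (\<lambda>v. B x v + B v x)) (at x)"
  by (rule bounded_bilinear.FDERIV[OF assms has_derivative_ident has_derivative_ident])

lemma smooth_half_quadratic:
  fixes B :: "'v::real_normed_vector \<Rightarrow> 'v \<Rightarrow> real"
  assumes B: "bounded_bilinear B" and sym: "\<And>x y. B x y = B y x"
  shows "smooth (\<lambda>x. B x x / 2)"
    and "((\<lambda>x. B x x / 2) has_derivative B x) (at x)"
proof -
  show D: "((\<lambda>x. B x x / 2) has_derivative B x) (at x)" for x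
  proof -
    have "((\<lambda>x. B x x / 2) has_derivative (\<lambda>v. (B x v + B v x) / 2)) (at x)"
      using has_derivative_divide[OF has_derivative_quadratic[OF B] has_derivative_const, of 2]
      by simp
    then show ?thesis
      by (simp add: sym[of _ x])
  qed
  have diff: "\<And>x. (\<lambda>x. B x x / 2) differentiable (at x)"
    using D by (auto simp: differentiable_def)
  have "\<And>x. frechet_derivative (\<lambda>x. B x x / 2) (at x) = B x"
    using D by (metis frechet_derivative_at)
  \<comment> \<open>The derivative in direction \<open>v\<close> is
    \<open>\<lambda>x. B x v\<close>, a bounded linear map and so of every class
    \<open>Ck k\<close>.\<close>
  then have "Ck (Suc k) (\<lambda>x. B x x / 2)" for k
    using diff by (simp add: Ck_bounded_linear[OF bounded_bilinear.bounded_linear_left[OF B]])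
  moreover have "Ck 0 (\<lambda>x. B x x / 2)"
    using diff by (simp add: continuous_on_eq_continuous_within differentiable_imp_continuous_within)
  ultimately show "smooth (\<lambda>x. B x x / 2)"
    unfolding smooth_def by (metis not0_implies_Suc)
qed

lemma potential_of_linear_form_quadratic:
  fixes B :: "'v::real_normed_vector \<Rightarrow> 'v \<Rightarrow> real"
  assumes B: "bounded_bilinear B" and H: "\<And>x. (H has_derivative B x) (at x)"
  shows "H x = H 0 + B x x / 2"
proof -
  interpret bounded_bilinear B by (rule B)
  \<comment> \<open>By the chain rule, \<open>H\<close> along the ray has derivative
    \<open>B (t x) x = t * B x x\<close>, which the quadratic term cancels. Comparing
    \<open>t = 1\<close> with \<open>t = 0\<close> then gives the formula.\<close>
  have "((\<lambda>t. H (t *\<^sub>R x) - t\<^sup>2 * (B x x / 2)) has_real_derivative 0) (at t)" for t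
  proof -
    have "((\<lambda>t. H (t *\<^sub>R x)) has_derivative (\<lambda>s. B (t *\<^sub>R x) (s *\<^sub>R x))) (at t)"
      by (rule has_derivative_compose[OF _ H]) (auto intro!: derivative_eq_intros)
    then have "((\<lambda>t. H (t *\<^sub>R x)) has_real_derivative t * B x x) (at t)"
      unfolding has_field_derivative_def by (simp add: scaleR_left scaleR_right mult_ac mult_commute_abs)
    then show ?thesis
      by (auto intro!: derivative_eq_intros)
  qed
  from DERIV_isconst_all[OF allI[OF this], of 1 0] show ?thesis
    by simp
qed

lemma potential_imp_symmetric:
  fixes B :: "'v::real_normed_vector \<Rightarrow> 'v \<Rightarrow> real"
  assumes B: "bounded_bilinear B" and H: "\<And>x. (H has_derivative B x) (at x)"
  shows "B x y = B y x"
proof -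
  have "H = (\<lambda>x. H 0 + B x x / 2)"
    using potential_of_linear_form_quadratic[OF B H] by blast
  moreover have "((\<lambda>x. H 0 + B x x / 2) has_derivative (\<lambda>v. (B x v + B v x) / 2)) (at x)"
    by (auto intro!: derivative_eq_intros has_derivative_quadratic[OF B])
  ultimately have "(H has_derivative (\<lambda>v. (B x v + B v x) / 2)) (at x)"
    by simp
  \<comment> \<open>Both \<open>B x\<close> and the symmetrized form are derivatives of
    \<open>H\<close> at \<open>x\<close>, so they agree.\<close>
  from has_derivative_unique[OF H this] have "B x y = (B x y + B y x) / 2"
    by metis
  then show ?thesis by simp
qed

theorem proposition4p6:
  fixes b :: "'m::finite \<Rightarrow> 'v::real_normed_vector"
    and \<omega> :: "'v \<Rightarrow> 'v \<Rightarrow> real"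
    and L :: "real^'m^'m"
    and n :: nat
  assumes "is_basis b"
    and "CARD('m) = 2 * n"
    and "symplectic_form \<omega>"
  shows "L \<in> sp_algebra b \<omega> \<longleftrightarrow> hamiltonian_field \<omega> (linear_field b L)"
proof -
  let ?A = "linear_field b L"
  let ?B = "\<lambda>x. \<omega> (?A x)"
  have \<omega>: "bilinear \<omega>"
    using assms(3) by (simp add: symplectic_form_def)
  then have "bilinear ?B"
    using linear_linear_field[OF assms(1), of L]
    unfolding bilinear_def by (auto intro: linear_compose[unfolded o_def])
  then have B: "bounded_bilinear ?B"
    by (rule bounded_bilinear_of_basis[OF assms(1)])
  \<comment> \<open>Skewness rewrites \<open>\<omega> x (?A y)\<close> as \<open>- ?B y x\<close>,
    so the vanishing sum becomes symmetry of \<open>?B\<close>.\<close>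
  have "L \<in> sp_algebra b \<omega> \<longleftrightarrow> (\<forall>x y. ?B x y = ?B y x)"
    unfolding sp_algebra_iff[OF assms(1) \<omega>]
    by (metis symplectic_form_skew[OF assms(3)] add.right_inverse add_eq_0_iff minus_minus)
  \<comment> \<open>From left to right the witness for \<open>H\<close> is
    \<open>\<lambda>x. ?B x x / 2\<close>.\<close>
  also have "\<dots> \<longleftrightarrow> hamiltonian_field \<omega> ?A"
    unfolding hamiltonian_field_def
    using smooth_half_quadratic[OF B] potential_imp_symmetric[OF B] by meson
  finally show ?thesis .
qed

end
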